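(* Let $\mathscr C$ be a set and let $S=X\times Y$ be a partial rectangular band over $\mathscr C$, built from pairwise disjoint non-empty sets $X_A$ ($A\in\mathscr C$) and pairwise disjoint non-empty sets $Y_A$ ($A\in\mathscr C$), with $X=\bigcup_{A}X_A$ and $Y=\bigcup_AY_A$. For two $\mathscr C$-tuples of equivalences $\mathcal E_1=(\varepsilon_1^A)_{A\in\mathscr C}\in\prod_{A\in\mathscr C}\mathfrak{Eq}(X_A)$ and $\mathcal E_2=(\varepsilon_2^A)_{A\in\mathscr C}\in\prod_{A\in\mathscr C}\mathfrak{Eq}(Y_A)$ define $$\sigma_{\mathcal E_1,\mathcal E_2}=\bigcup_{A,B\in\mathscr C}\big\{\big((x_1,y_1),(x_2,y_2)\big)\in (X_A\times Y_B)\times(X_A\times Y_B):\ (x_1,x_2)\in\varepsilon_1^A,\ (y_1,y_2)\in\varepsilon_2^B\big\}.$$ Then: (i) $\operatorname{Cong}(S)=\big\{\sigma_{\mathcal E_1,\mathcal E_2}:\ \mathcal E_1\in\prod_{A\in\mathscr C}\mathfrak{Eq}(X_A),\ \mathcal E_2\in\prod_{A\in\mathscr C}\mathfrak{Eq}(Y_A)\big\}$; (ii) $\operatorname{Cong}(S)$ is isomorphic to the lattice direct product $\prod_{A\in\mathscr C}\mathfrak{Eq}(X_A)\times\prod_{A\in\mathscr C}\mathfrak{Eq}(Y_A)$.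
   Context: $\mathfrak{Eq}(Z)$ is the lattice of all equivalence relations on the set $Z$. A partial semigroup is a 5-tuple $(S,\mathscr C,\mathbf d,\mathbf r,\cdot)$ with $\mathbf d,\mathbf r:S\to\mathscr C$ and $\cdot$ a partial binary operation on $S$ such that $xy$ is defined iff $\mathbf r(x)=\mathbf d(y)$, in which case $\mathbf d(xy)=\mathbf d(x)$, $\mathbf r(xy)=\mathbf r(y)$, and $(xy)z=x(yz)$ whenever $xy$ and $yz$ are defined. A congruence on $S$ is an equivalence $\sigma$ such that $(x,y)\in\sigma$ implies $\mathbf d(x)=\mathbf d(y)$ and $\mathbf r(x)=\mathbf r(y)$, and $(ax,ay)\in\sigma$ whenever $\mathbf r(a)=\mathbf d(x)$, and $(xa,ya)\in\sigma$ whenever $\mathbf d(a)=\mathbf r(x)$. $\operatorname{Cong}(S)$ is the lattice of all congruences under inclusion. Partial rectangular band: given $\mathscr C$, $X_A$, $Y_A$, $X$, $Y$ as in the claim ($X$ and $Y$ need not be disjoint from each other), it is the partial semigroup $S=X\times Y=\bigcup_{A,B}(X_A\times Y_B)$ with object set $\mathscr C$, where $\mathbf d(x,y)=A$ and $\mathbf r(x,y)=B$ for $x\in X_A$, $y\in Y_B$, and $(x_1,y_1)\cdot(x_2,y_2)=(x_1,y_2)$ whenever $\mathbf r(x_1,y_1)=\mathbf d(x_2,y_2)$. *)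

theory Defs
  imports "HOL-Algebra.Lattice" "HOL-Library.FuncSet" "HOL-Library.Disjoint_Sets"
begin

section \<open>Partial semigroups and their congruences\<close>

text \<open>The product of two elements is \<^const>\<open>None\<close> when it is undefined.\<close>

record ('s, 'c) partial_semigroup = "'s partial_object" +
  objects :: "'c set"
  dom_of :: "'s \<Rightarrow> 'c"
  ran_of :: "'s \<Rightarrow> 'c"
  comp :: "'s \<Rightarrow> 's \<Rightarrow> 's option"

locale is_partial_semigroup =
  fixes S :: "('s, 'c, 'm) partial_semigroup_scheme"
  assumes dom_closed: "x \<in> carrier S \<Longrightarrow> dom_of S x \<in> objects S"
    and ran_closed: "x \<in> carrier S \<Longrightarrow> ran_of S x \<in> objects S"
    and comp_defined_iff: "\<lbrakk>x \<in> carrier S; y \<in> carrier S\<rbrakk> \<Longrightarrow>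
      (\<exists>u. comp S x y = Some u) \<longleftrightarrow> ran_of S x = dom_of S y"
    and comp_closed: "\<lbrakk>x \<in> carrier S; y \<in> carrier S; comp S x y = Some u\<rbrakk> \<Longrightarrow> u \<in> carrier S"
    and dom_comp: "\<lbrakk>x \<in> carrier S; y \<in> carrier S; comp S x y = Some u\<rbrakk> \<Longrightarrow> dom_of S u = dom_of S x"
    and ran_comp: "\<lbrakk>x \<in> carrier S; y \<in> carrier S; comp S x y = Some u\<rbrakk> \<Longrightarrow> ran_of S u = ran_of S y"
    and comp_assoc: "\<lbrakk>x \<in> carrier S; y \<in> carrier S; z \<in> carrier S;
        comp S x y = Some u; comp S y z = Some v\<rbrakk> \<Longrightarrow> comp S u z = comp S x v"

definition is_congruence :: "('s, 'c, 'm) partial_semigroup_scheme \<Rightarrow> 's rel \<Rightarrow> bool" where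
  "is_congruence S \<sigma> \<longleftrightarrow>
     equiv (carrier S) \<sigma> \<and>
     (\<forall>(x, y) \<in> \<sigma>. dom_of S x = dom_of S y \<and> ran_of S x = ran_of S y) \<and>
     (\<forall>(x, y) \<in> \<sigma>. \<forall>a \<in> carrier S. ran_of S a = dom_of S x \<longrightarrow>
        (\<exists>u v. comp S a x = Some u \<and> comp S a y = Some v \<and> (u, v) \<in> \<sigma>)) \<and>
     (\<forall>(x, y) \<in> \<sigma>. \<forall>a \<in> carrier S. dom_of S a = ran_of S x \<longrightarrow>
        (\<exists>u v. comp S x a = Some u \<and> comp S y a = Some v \<and> (u, v) \<in> \<sigma>))"

definition Cong :: "('s, 'c, 'm) partial_semigroup_scheme \<Rightarrow> 's rel set" where
  "Cong S = {\<sigma>. is_congruence S \<sigma>}"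


section \<open>Lattices of relations, direct products, isomorphism\<close>

definition Eq :: "'a set \<Rightarrow> 'a rel set" where
  "Eq Z = {r. equiv Z r}"

definition inclusion_order :: "'a set set \<Rightarrow> 'a set gorder" where
  "inclusion_order F = \<lparr>carrier = F, eq = (=), le = (\<subseteq>)\<rparr>"

definition Eq_lattice :: "'a set \<Rightarrow> 'a rel gorder" where
  "Eq_lattice Z = inclusion_order (Eq Z)"

definition Cong_lattice :: "('s, 'c, 'm) partial_semigroup_scheme \<Rightarrow> 's rel gorder" where
  "Cong_lattice S = inclusion_order (Cong S)"

text \<open>
  Direct products are given by the componentwise order; for lattices, joins and meets are then
  componentwise too. Tuples over \<open>I\<close> are extensional functions, so that distinct
  functions are distinct tuples.
\<close>

definition product_order :: "'i set \<Rightarrow> ('i \<Rightarrow> 'a gorder) \<Rightarrow> ('i \<Rightarrow> 'a) gorder" where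
  "product_order I L =
     \<lparr>carrier = (\<Pi>\<^sub>E i\<in>I. carrier (L i)), eq = (=), le = (\<lambda>f g. \<forall>i\<in>I. f i \<sqsubseteq>\<^bsub>L i\<^esub> g i)\<rparr>"

definition binary_product_order :: "'a gorder \<Rightarrow> 'b gorder \<Rightarrow> ('a \<times> 'b) gorder" where
  "binary_product_order L M =
     \<lparr>carrier = carrier L \<times> carrier M, eq = (=),
      le = (\<lambda>p q. fst p \<sqsubseteq>\<^bsub>L\<^esub> fst q \<and> snd p \<sqsubseteq>\<^bsub>M\<^esub> snd q)\<rparr>"

text \<open>
  Both \<^const>\<open>join_pres\<close> and \<^const>\<open>meet_pres\<close> include that their two
  arguments are lattices.
\<close>

definition lattice_isomorphic :: "'a gorder \<Rightarrow> 'b gorder \<Rightarrow> bool" where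
  "lattice_isomorphic L M \<longleftrightarrow>
     (\<exists>h. bij_betw h (carrier L) (carrier M) \<and> join_pres L M h \<and> meet_pres L M h)"


section \<open>Partial rectangular bands\<close>

text \<open>
  Under the standing assumption that \<open>X\<close> is disjoint over \<open>C\<close>, \<open>index_of C X x\<close> is
  the unique \<open>A \<in> C\<close> with \<open>x \<in> X A\<close>.
\<close>

definition index_of :: "'c set \<Rightarrow> ('c \<Rightarrow> 'a set) \<Rightarrow> 'a \<Rightarrow> 'c" where
  "index_of C X x = (THE A. A \<in> C \<and> x \<in> X A)"

definition partial_rectangular_band ::
    "'c set \<Rightarrow> ('c \<Rightarrow> 'x set) \<Rightarrow> ('c \<Rightarrow> 'y set) \<Rightarrow> ('x \<times> 'y, 'c) partial_semigroup" where
  "partial_rectangular_band C X Y =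
     \<lparr>carrier = (\<Union>A\<in>C. X A) \<times> (\<Union>B\<in>C. Y B),
      objects = C,
      dom_of = (\<lambda>p. index_of C X (fst p)),
      ran_of = (\<lambda>p. index_of C Y (snd p)),
      comp = (\<lambda>p q. if index_of C Y (snd p) = index_of C X (fst q)
                    then Some (fst p, snd q) else None)\<rparr>"

lemma index_of_eq:
  assumes "disjoint_family_on X C" "A \<in> C" "x \<in> X A"
  shows "index_of C X x = A"
  unfolding index_of_def
proof (rule the_equality)
  fix B assume "B \<in> C \<and> x \<in> X B"
  with assms show "B = A"
    unfolding disjoint_family_on_def by blast
qed (use assms in simp)

lemma is_partial_semigroup_partial_rectangular_band:
  assumes "disjoint_family_on X C" "disjoint_family_on Y C"
  shows "is_partial_semigroup (partial_rectangular_band C X Y)"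
  using assms
  by unfold_locales
    (auto simp: partial_rectangular_band_def index_of_eq split: if_splits)

definition sigma_rel ::
    "'c set \<Rightarrow> ('c \<Rightarrow> 'x set) \<Rightarrow> ('c \<Rightarrow> 'y set) \<Rightarrow> ('c \<Rightarrow> 'x rel) \<Rightarrow> ('c \<Rightarrow> 'y rel) \<Rightarrow> ('x \<times> 'y) rel" where
  "sigma_rel C X Y E1 E2 =
     (\<Union>A\<in>C. \<Union>B\<in>C. {((x1, y1), (x2, y2)) | x1 y1 x2 y2.
        ((x1, y1), (x2, y2)) \<in> (X A \<times> Y B) \<times> (X A \<times> Y B) \<and> (x1, x2) \<in> E1 A \<and> (y1, y2) \<in> E2 B})"

end

theory Submission
  imports Defs
begin

text \<open>
  Multiplying a pair \<open>((x1, y1), (x2, y2))\<close> of a congruence on the right by \<open>(x', y)\<close> replaces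
  both second coordinates by the same \<open>y\<close>, and \<open>y\<close> is arbitrary because the sets \<open>X A\<close> are
  non-empty; dually on the left. By transitivity a congruence is therefore determined by the
  equivalences it induces on the sets \<open>X A\<close> and \<open>Y A\<close>. Since \<open>\<sigma>\<close> is monotone in these
  equivalences and they can be read off from it, it is an order isomorphism from the product
  lattice onto the congruences, hence a lattice isomorphism.
\<close>

section \<open>Lattices given by order\<close>

text \<open>The meet is the intersection, and the join is the intersection of all members above both
  arguments. The top member \<open>T\<close> guarantees that this last family is non-empty, so that
  \<open>Inter\<close> applies to it.\<close>

lemma lattice_inclusion_order:
  assumes Inter: "\<And>G. G \<subseteq> F \<Longrightarrow> G \<noteq> {} \<Longrightarrow> \<Inter>G \<in> F"
    and top: "T \<in> F" "\<And>A. A \<in> F \<Longrightarrow> A \<subseteq> T"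
  shows "lattice (inclusion_order F)"
proof
  fix A B assume "A \<in> carrier (inclusion_order F)" "B \<in> carrier (inclusion_order F)"
  then have AB: "A \<in> F" "B \<in> F" by (simp_all add: inclusion_order_def)
  let ?G = "{D \<in> F. A \<subseteq> D \<and> B \<subseteq> D}"
  have "\<Inter>?G \<in> F" using AB top by (intro Inter) auto
  then have "least (inclusion_order F) (\<Inter>?G) (Upper (inclusion_order F) {A, B})"
    using AB by (auto simp: least_def Upper_def inclusion_order_def)
  then show "\<exists>s. least (inclusion_order F) s (Upper (inclusion_order F) {A, B})" ..
  have "A \<inter> B \<in> F" using Inter[of "{A, B}"] AB by simp
  then have "greatest (inclusion_order F) (A \<inter> B) (Lower (inclusion_order F) {A, B})"
    using AB by (auto simp: greatest_def Lower_def inclusion_order_def)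
  then show "\<exists>s. greatest (inclusion_order F) s (Lower (inclusion_order F) {A, B})" ..
qed (auto simp: inclusion_order_def)

lemma lattice_Eq_lattice: "lattice (Eq_lattice Z)"
  unfolding Eq_lattice_def
proof (rule lattice_inclusion_order)
  fix G assume G: "G \<subseteq> Eq Z" "G \<noteq> {}"
  then have eqv: "equiv Z r" if "r \<in> G" for r using that by (auto simp: Eq_def)
  have "equiv Z (\<Inter>G)"
  proof (rule equivI)
    \<comment> \<open>Non-emptiness of \<open>G\<close> matters here: the empty intersection is the
      universal relation on the type, which need not lie in \<open>Z \<times> Z\<close>.\<close>
    show "\<Inter>G \<subseteq> Z \<times> Z" using eqv G(2) by (fastforce simp: equiv_def)
    show "refl_on Z (\<Inter>G)" using eqv by (auto simp: refl_on_def equiv_def)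
    show "sym (\<Inter>G)" using eqv by (meson InterE InterI equivE symD symI)
    show "trans (\<Inter>G)" using eqv by (meson InterE InterI equivE transD transI)
  qed
  then show "\<Inter>G \<in> Eq Z" by (simp add: Eq_def)
next
  show "Z \<times> Z \<in> Eq Z"
    by (auto simp: Eq_def equiv_def refl_on_def sym_def trans_def)
qed (auto simp: Eq_def equiv_def)

section \<open>Direct products of lattices\<close>

text \<open>Eliminates \<open>Upper\<close> in favour of the universal property of a join, which
  involves only the order and the carrier. In this form joins can be compared componentwise and
  transported along bijections.\<close>

lemma least_Upper_pair_iff:
  assumes "x \<in> carrier L" "y \<in> carrier L"
  shows "least L s (Upper L {x, y}) \<longleftrightarrow>
    s \<in> carrier L \<and> x \<sqsubseteq>\<^bsub>L\<^esub> s \<and> y \<sqsubseteq>\<^bsub>L\<^esub> s \<and>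
    (\<forall>u\<in>carrier L. x \<sqsubseteq>\<^bsub>L\<^esub> u \<and> y \<sqsubseteq>\<^bsub>L\<^esub> u \<longrightarrow> s \<sqsubseteq>\<^bsub>L\<^esub> u)"
  using assms by (auto simp: least_def Upper_def)

lemma greatest_Lower_pair_iff:
  assumes "x \<in> carrier L" "y \<in> carrier L"
  shows "greatest L s (Lower L {x, y}) \<longleftrightarrow>
    s \<in> carrier L \<and> s \<sqsubseteq>\<^bsub>L\<^esub> x \<and> s \<sqsubseteq>\<^bsub>L\<^esub> y \<and>
    (\<forall>u\<in>carrier L. u \<sqsubseteq>\<^bsub>L\<^esub> x \<and> u \<sqsubseteq>\<^bsub>L\<^esub> y \<longrightarrow> u \<sqsubseteq>\<^bsub>L\<^esub> s)"
  using assms by (auto simp: greatest_def Lower_def)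

text \<open>Orders in HOL-Algebra are relative to an equivalence \<open>eq\<close>. Once this is
  equality, the axioms about it and the compatibility of the order with it are trivial, which leaves
  the familiar lattice axioms.\<close>

lemma latticeI:
  assumes eq: "eq L = (=)"
    and refl: "\<And>x. x \<in> carrier L \<Longrightarrow> x \<sqsubseteq>\<^bsub>L\<^esub> x"
    and antisym: "\<And>x y. \<lbrakk>x \<in> carrier L; y \<in> carrier L; x \<sqsubseteq>\<^bsub>L\<^esub> y; y \<sqsubseteq>\<^bsub>L\<^esub> x\<rbrakk> \<Longrightarrow> x = y"
    and trans: "\<And>x y z. \<lbrakk>x \<in> carrier L; y \<in> carrier L; z \<in> carrier L;
        x \<sqsubseteq>\<^bsub>L\<^esub> y; y \<sqsubseteq>\<^bsub>L\<^esub> z\<rbrakk> \<Longrightarrow> x \<sqsubseteq>\<^bsub>L\<^esub> z"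
    and lub: "\<And>x y. \<lbrakk>x \<in> carrier L; y \<in> carrier L\<rbrakk> \<Longrightarrow> \<exists>s. least L s (Upper L {x, y})"
    and glb: "\<And>x y. \<lbrakk>x \<in> carrier L; y \<in> carrier L\<rbrakk> \<Longrightarrow> \<exists>s. greatest L s (Lower L {x, y})"
  shows "lattice L"
proof (unfold_locales, unfold eq)
  show "x \<sqsubseteq>\<^bsub>L\<^esub> z"
    if "x \<sqsubseteq>\<^bsub>L\<^esub> y" "y \<sqsubseteq>\<^bsub>L\<^esub> z" "x \<in> carrier L" "y \<in> carrier L" "z \<in> carrier L" for x y z
    using trans[of x y z] that by simp
qed (simp_all add: refl antisym lub glb)

context lattice
begin

lemma least_join:
  assumes "x \<in> carrier L" "y \<in> carrier L"
  shows "least L (x \<squnion> y) (Upper L {x, y})"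
  using sup_of_two_least[OF assms] by (simp add: join_def)

lemma greatest_meet:
  assumes "x \<in> carrier L" "y \<in> carrier L"
  shows "greatest L (x \<sqinter> y) (Lower L {x, y})"
  using inf_of_two_greatest[OF assms] by (simp add: meet_def)

end

lemma lattice_product_order:
  assumes L: "\<And>i. i \<in> I \<Longrightarrow> lattice (L i)"
  shows "lattice (product_order I L)"
proof -
  have po: "partial_order (L i)" if "i \<in> I" for i
    using L[OF that] by (simp add: lattice_def upper_semilattice_def)
  then have wpo: "weak_partial_order (L i)" if "i \<in> I" for i
    using that by (simp add: partial_order_def)
  show ?thesis
  proof (rule latticeI)
    fix f g assume carr: "f \<in> carrier (product_order I L)" "g \<in> carrier (product_order I L)"
    then have fg: "f i \<in> carrier (L i)" "g i \<in> carrier (L i)" if "i \<in> I" for i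
      using that by (auto simp: product_order_def)
    have join: "least (L i) (f i \<squnion>\<^bsub>L i\<^esub> g i) (Upper (L i) {f i, g i})"
      and meet: "greatest (L i) (f i \<sqinter>\<^bsub>L i\<^esub> g i) (Lower (L i) {f i, g i})" if "i \<in> I" for i
      by (rule lattice.least_join[OF L[OF that] fg[OF that]]
          lattice.greatest_meet[OF L[OF that] fg[OF that]])+
    \<comment> \<open>The restricted abstraction makes the tuple of joins extensional, as membership
      in the carrier of the product demands.\<close>
    have "least (product_order I L) (\<lambda>i\<in>I. f i \<squnion>\<^bsub>L i\<^esub> g i) (Upper (product_order I L) {f, g})"
      using join unfolding least_Upper_pair_iff[OF carr]
      by (auto simp: least_Upper_pair_iff fg product_order_def PiE_iff)
    then show "\<exists>s. least (product_order I L) s (Upper (product_order I L) {f, g})" by blast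
    have "greatest (product_order I L) (\<lambda>i\<in>I. f i \<sqinter>\<^bsub>L i\<^esub> g i) (Lower (product_order I L) {f, g})"
      using meet unfolding greatest_Lower_pair_iff[OF carr]
      by (auto simp: greatest_Lower_pair_iff fg product_order_def PiE_iff)
    then show "\<exists>s. greatest (product_order I L) s (Lower (product_order I L) {f, g})" by blast
    assume le: "f \<sqsubseteq>\<^bsub>product_order I L\<^esub> g" "g \<sqsubseteq>\<^bsub>product_order I L\<^esub> f"
    have "f i = g i" if "i \<in> I" for i
      using le that by (intro partial_order.le_antisym[OF po[OF that]] fg) (simp_all add: product_order_def)
    \<comment> \<open>Antisymmetry gives equality only at indices in \<open>I\<close>;
      extensionality of both tuples settles the remaining arguments.\<close>
    with carr show "f = g" by (auto simp: product_order_def intro: PiE_ext)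
  next
    fix f assume "f \<in> carrier (product_order I L)"
    then show "f \<sqsubseteq>\<^bsub>product_order I L\<^esub> f"
      using wpo by (auto simp: product_order_def intro!: weak_partial_order.le_refl)
  next
    fix f g h
    assume "f \<in> carrier (product_order I L)" "g \<in> carrier (product_order I L)"
      "h \<in> carrier (product_order I L)"
      "f \<sqsubseteq>\<^bsub>product_order I L\<^esub> g" "g \<sqsubseteq>\<^bsub>product_order I L\<^esub> h"
    then have "f i \<sqsubseteq>\<^bsub>L i\<^esub> h i" if "i \<in> I" for i
      using that by (intro weak_partial_order.le_trans[OF wpo[OF that], of "f i" "g i" "h i"])
        (auto simp: product_order_def)
    then show "f \<sqsubseteq>\<^bsub>product_order I L\<^esub> h" by (simp add: product_order_def)
  qed (simp add: product_order_def)
qed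

lemma lattice_binary_product_order:
  assumes "lattice L" "lattice M"
  shows "lattice (binary_product_order L M)"
proof -
  interpret L: lattice L by fact
  interpret M: lattice M by fact
  show ?thesis
  proof (rule latticeI)
    fix p q
    assume carr: "p \<in> carrier (binary_product_order L M)" "q \<in> carrier (binary_product_order L M)"
    then have pq: "fst p \<in> carrier L" "fst q \<in> carrier L" "snd p \<in> carrier M" "snd q \<in> carrier M"
      by (auto simp: binary_product_order_def)
    note lub = L.least_join[OF pq(1,2)] M.least_join[OF pq(3,4)]
      L.greatest_meet[OF pq(1,2)] M.greatest_meet[OF pq(3,4)]
    have "least (binary_product_order L M) (fst p \<squnion>\<^bsub>L\<^esub> fst q, snd p \<squnion>\<^bsub>M\<^esub> snd q)
        (Upper (binary_product_order L M) {p, q})"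
      using lub(1,2) pq unfolding least_Upper_pair_iff[OF carr]
      by (auto simp: least_Upper_pair_iff binary_product_order_def)
    then show "\<exists>s. least (binary_product_order L M) s (Upper (binary_product_order L M) {p, q})" ..
    have "greatest (binary_product_order L M) (fst p \<sqinter>\<^bsub>L\<^esub> fst q, snd p \<sqinter>\<^bsub>M\<^esub> snd q)
        (Lower (binary_product_order L M) {p, q})"
      using lub(3,4) pq unfolding greatest_Lower_pair_iff[OF carr]
      by (auto simp: greatest_Lower_pair_iff binary_product_order_def)
    then show "\<exists>s. greatest (binary_product_order L M) s (Lower (binary_product_order L M) {p, q})" ..
  qed (auto simp: binary_product_order_def intro: L.le_trans M.le_trans)
qed

section \<open>Order isomorphisms as lattice isomorphisms\<close>

text \<open>Joins and meets are determined by the order, so an order isomorphism preserves them.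
  Only \<open>M\<close> has to be known to be a lattice: bounds in \<open>L\<close> are the
  preimages of bounds in \<open>M\<close>. This spares a separate proof that the congruences form a
  lattice.\<close>

lemma lattice_isomorphicI:
  assumes "lattice M" and eq: "eq L = (=)"
    and bij: "bij_betw h (carrier L) (carrier M)"
    and emb: "\<And>x y. \<lbrakk>x \<in> carrier L; y \<in> carrier L\<rbrakk> \<Longrightarrow> h x \<sqsubseteq>\<^bsub>M\<^esub> h y \<longleftrightarrow> x \<sqsubseteq>\<^bsub>L\<^esub> y"
  shows "lattice_isomorphic L M"
proof -
  interpret M: lattice M by fact
  have h: "h x \<in> carrier M" if "x \<in> carrier L" for x
    using bij that by (auto simp: bij_betw_def)
  have surj: "carrier M = h ` carrier L" using bij by (simp add: bij_betw_def)
  \<comment> \<open>Since \<open>h\<close> is onto, quantifying over \<open>carrier M\<close>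
    amounts to quantifying over the values of \<open>h\<close>, and \<open>emb\<close> then
    translates each inequality.\<close>
  have lub: "least L s (Upper L {x, y}) \<longleftrightarrow> least M (h s) (Upper M {h x, h y})"
    and glb: "greatest L s (Lower L {x, y}) \<longleftrightarrow> greatest M (h s) (Lower M {h x, h y})"
    if "x \<in> carrier L" "y \<in> carrier L" "s \<in> carrier L" for x y s
    using that h
    by (simp_all add: least_Upper_pair_iff greatest_Lower_pair_iff surj emb)
  interpret L: lattice L
  proof (rule latticeI)
    fix x y assume xy: "x \<in> carrier L" "y \<in> carrier L"
    then have "h x \<squnion>\<^bsub>M\<^esub> h y \<in> h ` carrier L" "h x \<sqinter>\<^bsub>M\<^esub> h y \<in> h ` carrier L"
      using h surj by (metis M.join_closed, metis M.meet_closed)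
    then obtain s t where "s \<in> carrier L" "h s = h x \<squnion>\<^bsub>M\<^esub> h y"
      "t \<in> carrier L" "h t = h x \<sqinter>\<^bsub>M\<^esub> h y" by (metis imageE)
    then show "\<exists>s. least L s (Upper L {x, y})" "\<exists>t. greatest L t (Lower L {x, y})"
      using lub glb xy h M.least_join M.greatest_meet by metis+
    assume "x \<sqsubseteq>\<^bsub>L\<^esub> y" "y \<sqsubseteq>\<^bsub>L\<^esub> x"
    then have "h x = h y" using emb h xy by (intro M.le_antisym) auto
    then show "x = y" using bij xy by (auto simp: bij_betw_def dest: inj_onD)
  next
    fix x assume "x \<in> carrier L"
    then show "x \<sqsubseteq>\<^bsub>L\<^esub> x" using emb h M.le_refl by blast
  next
    fix x y z
    assume "x \<in> carrier L" "y \<in> carrier L" "z \<in> carrier L" "x \<sqsubseteq>\<^bsub>L\<^esub> y" "y \<sqsubseteq>\<^bsub>L\<^esub> z"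
    then show "x \<sqsubseteq>\<^bsub>L\<^esub> z" using emb h M.le_trans by meson
  qed (fact eq)
  have "h (x \<squnion>\<^bsub>L\<^esub> y) = h x \<squnion>\<^bsub>M\<^esub> h y" "h (x \<sqinter>\<^bsub>L\<^esub> y) = h x \<sqinter>\<^bsub>M\<^esub> h y"
    if xy: "x \<in> carrier L" "y \<in> carrier L" for x y
  proof -
    show "h (x \<squnion>\<^bsub>L\<^esub> y) = h x \<squnion>\<^bsub>M\<^esub> h y"
      using L.least_join[OF xy] lub[OF xy L.join_closed[OF xy]] M.least_join[OF h h, OF xy]
      by (metis M.least_unique)
    show "h (x \<sqinter>\<^bsub>L\<^esub> y) = h x \<sqinter>\<^bsub>M\<^esub> h y"
      using L.greatest_meet[OF xy] glb[OF xy L.meet_closed[OF xy]] M.greatest_meet[OF h h, OF xy]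
      by (metis M.greatest_unique)
  qed
  with bij L.lattice_axioms M.lattice_axioms show ?thesis
    unfolding lattice_isomorphic_def join_pres_def meet_pres_def by blast
qed


section \<open>Congruences of partial rectangular bands\<close>

locale rectangular_band_data =
  fixes C :: "'c set" and X :: "'c \<Rightarrow> 'x set" and Y :: "'c \<Rightarrow> 'y set"
  assumes disjoint_X: "disjoint_family_on X C" and nonempty_X: "A \<in> C \<Longrightarrow> X A \<noteq> {}"
    and disjoint_Y: "disjoint_family_on Y C" and nonempty_Y: "A \<in> C \<Longrightarrow> Y A \<noteq> {}"
begin

abbreviation band where "band \<equiv> partial_rectangular_band C X Y"

abbreviation Eqs_X where "Eqs_X \<equiv> \<Pi>\<^sub>E A\<in>C. Eq (X A)"

abbreviation Eqs_Y where "Eqs_Y \<equiv> \<Pi>\<^sub>E A\<in>C. Eq (Y A)"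

lemma index_X [simp]: "A \<in> C \<Longrightarrow> x \<in> X A \<Longrightarrow> index_of C X x = A"
  using disjoint_X by (rule index_of_eq)

lemma index_Y [simp]: "A \<in> C \<Longrightarrow> y \<in> Y A \<Longrightarrow> index_of C Y y = A"
  using disjoint_Y by (rule index_of_eq)

text \<open>Disjointness forces the indices in the union defining \<open>sigma_rel\<close> to be
  those of \<open>x1\<close> and \<open>y1\<close>. Nothing is assumed about \<open>x2\<close> and
  \<open>y2\<close>, because an equivalence on \<open>X A\<close> or \<open>Y B\<close> relates only
  points of that set.\<close>

lemma sigma_rel_iff:
  assumes "E1 \<in> Eqs_X" "E2 \<in> Eqs_Y" "A \<in> C" "B \<in> C" "x1 \<in> X A" "y1 \<in> Y B"
  shows "((x1, y1), (x2, y2)) \<in> sigma_rel C X Y E1 E2 \<longleftrightarrow> (x1, x2) \<in> E1 A \<and> (y1, y2) \<in> E2 B"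
proof
  assume "((x1, y1), (x2, y2)) \<in> sigma_rel C X Y E1 E2"
  then obtain A' B' where *: "A' \<in> C" "B' \<in> C" "x1 \<in> X A'" "y1 \<in> Y B'"
    "(x1, x2) \<in> E1 A'" "(y1, y2) \<in> E2 B'"
    by (auto simp: sigma_rel_def)
  with assms have "A' = A" "B' = B" using index_X index_Y by metis+
  with * show "(x1, x2) \<in> E1 A \<and> (y1, y2) \<in> E2 B" by simp
next
  assume "(x1, x2) \<in> E1 A \<and> (y1, y2) \<in> E2 B"
  moreover from this have "x2 \<in> X A" "y2 \<in> Y B"
    using assms by (auto simp: PiE_iff Eq_def equiv_def)
  ultimately show "((x1, y1), (x2, y2)) \<in> sigma_rel C X Y E1 E2"
    using assms by (auto simp: sigma_rel_def)
qed

section \<open>Congruences and tuples of equivalences\<close>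

lemma sigma_rel_in_Cong:
  assumes E: "E1 \<in> Eqs_X" "E2 \<in> Eqs_Y"
  shows "sigma_rel C X Y E1 E2 \<in> Cong band"
proof -
  let ?\<sigma> = "sigma_rel C X Y E1 E2"
  have E1: "equiv (X A) (E1 A)" and E2: "equiv (Y A) (E2 A)" if "A \<in> C" for A
    using E that by (auto simp: PiE_iff Eq_def)
  have "equiv (carrier band) ?\<sigma>"
  proof (rule equivI)
    show "?\<sigma> \<subseteq> carrier band \<times> carrier band"
      by (auto simp: sigma_rel_def partial_rectangular_band_def)
    show "refl_on (carrier band) ?\<sigma>"
      using E1 E2 by (auto simp: sigma_rel_iff[OF E] partial_rectangular_band_def refl_on_def
          equiv_def)
    show "sym ?\<sigma>"
    proof (rule symI)
      fix p q assume "(p, q) \<in> ?\<sigma>"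
      then obtain A B x1 y1 x2 y2 where "p = (x1, y1)" "q = (x2, y2)"
        "A \<in> C" "B \<in> C" "x2 \<in> X A" "y2 \<in> Y B" "(x1, x2) \<in> E1 A" "(y1, y2) \<in> E2 B"
        by (auto simp: sigma_rel_def)
      moreover from this E1 E2 have "(x2, x1) \<in> E1 A" "(y2, y1) \<in> E2 B"
        by (meson equivE symE)+
      ultimately show "(q, p) \<in> ?\<sigma>" by (simp add: sigma_rel_iff[OF E])
    qed
    show "trans ?\<sigma>"
    proof (rule transI)
      fix p q r assume pq: "(p, q) \<in> ?\<sigma>" and qr: "(q, r) \<in> ?\<sigma>"
      obtain x1 y1 x2 y2 x3 y3 where eqs: "p = (x1, y1)" "q = (x2, y2)" "r = (x3, y3)"
        by (metis surj_pair)
      from pq obtain A B where AB: "A \<in> C" "B \<in> C"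
        and mem: "x1 \<in> X A" "y1 \<in> Y B" "x2 \<in> X A" "y2 \<in> Y B"
        by (auto simp: sigma_rel_def eqs)
      have "(x1, x2) \<in> E1 A" "(y1, y2) \<in> E2 B" "(x2, x3) \<in> E1 A" "(y2, y3) \<in> E2 B"
        using pq qr AB mem by (simp_all add: eqs sigma_rel_iff[OF E])
      with E1 E2 AB have "(x1, x3) \<in> E1 A" "(y1, y3) \<in> E2 B"
        by (meson equivE transE)+
      with AB mem show "(p, r) \<in> ?\<sigma>" by (simp add: eqs sigma_rel_iff[OF E])
    qed
  qed
  moreover have "dom_of band p = dom_of band q \<and> ran_of band p = ran_of band q"
    if "(p, q) \<in> ?\<sigma>" for p q
    using that by (auto simp: sigma_rel_def partial_rectangular_band_def)
  \<comment> \<open>Left multiplication by \<open>a\<close> gives both products the first coordinate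
    of \<open>a\<close> and keeps the second coordinates. The first coordinates are then related by
    reflexivity of a component of \<open>E1\<close>. Right multiplication is dual.\<close>
  moreover have "\<exists>u v. comp band a p = Some u \<and> comp band a q = Some v \<and> (u, v) \<in> ?\<sigma>"
    if "(p, q) \<in> ?\<sigma>" "a \<in> carrier band" "ran_of band a = dom_of band p" for p q a
    using that E1
    by (auto simp: sigma_rel_def partial_rectangular_band_def equiv_def refl_on_def) blast
  moreover have "\<exists>u v. comp band p a = Some u \<and> comp band q a = Some v \<and> (u, v) \<in> ?\<sigma>"
    if "(p, q) \<in> ?\<sigma>" "a \<in> carrier band" "dom_of band a = ran_of band p" for p q a
    using that E2
    by (auto simp: sigma_rel_def partial_rectangular_band_def equiv_def refl_on_def) blast
  ultimately show ?thesis
    unfolding Cong_def is_congruence_def by auto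
qed

lemma Cong_imp_sigma_rel:
  assumes "\<sigma> \<in> Cong band"
  obtains E1 E2 where "E1 \<in> Eqs_X" "E2 \<in> Eqs_Y" "\<sigma> = sigma_rel C X Y E1 E2"
proof -
  from assms have eqv: "equiv (carrier band) \<sigma>"
    and objs: "\<And>p q. (p, q) \<in> \<sigma> \<Longrightarrow> dom_of band p = dom_of band q \<and> ran_of band p = ran_of band q"
    and left: "\<And>p q a. \<lbrakk>(p, q) \<in> \<sigma>; a \<in> carrier band; ran_of band a = dom_of band p\<rbrakk> \<Longrightarrow>
        \<exists>u v. comp band a p = Some u \<and> comp band a q = Some v \<and> (u, v) \<in> \<sigma>"
    and right: "\<And>p q a. \<lbrakk>(p, q) \<in> \<sigma>; a \<in> carrier band; dom_of band a = ran_of band p\<rbrakk> \<Longrightarrow>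
        \<exists>u v. comp band p a = Some u \<and> comp band q a = Some v \<and> (u, v) \<in> \<sigma>"
    unfolding Cong_def is_congruence_def by blast+
  have refl: "(p, p) \<in> \<sigma>" if "p \<in> carrier band" for p
    using eqv that by (auto simp: equiv_def refl_on_def)
  have sym: "(q, p) \<in> \<sigma>" if "(p, q) \<in> \<sigma>" for p q
    using eqv that by (meson equivE symE)
  have trans: "(p, r) \<in> \<sigma>" if "(p, q) \<in> \<sigma>" "(q, r) \<in> \<sigma>" for p q r
    using eqv that by (meson equivE transE)
  have carr: "p \<in> carrier band" "q \<in> carrier band" if "(p, q) \<in> \<sigma>" for p q
    using eqv that by (auto simp: equiv_def)
  have band_carr: "carrier band = (\<Union>A\<in>C. X A) \<times> (\<Union>B\<in>C. Y B)"
    by (simp add: partial_rectangular_band_def)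
  have change_Y: "((x1, y), (x2, y)) \<in> \<sigma>"
    if \<sigma>: "((x1, y1), (x2, y2)) \<in> \<sigma>" and y: "y \<in> (\<Union>B\<in>C. Y B)" for x1 y1 x2 y2 y
  proof -
    from carr[OF \<sigma>] obtain B where "B \<in> C" "y1 \<in> Y B" by (auto simp: band_carr)
    \<comment> \<open>The factor \<open>(x, y)\<close> must have domain \<open>B\<close>, the range
      of \<open>(x1, y1)\<close>. By \<open>objs\<close> the other pair has the same range, so both
      products are defined.\<close>
    moreover obtain x where "x \<in> X B" using nonempty_X[OF \<open>B \<in> C\<close>] by blast
    ultimately show ?thesis
      using right[OF \<sigma>, of "(x, y)"] objs[OF \<sigma>] y
      by (auto simp: partial_rectangular_band_def split: if_splits)
  qed
  have change_X: "((x, y1), (x, y2)) \<in> \<sigma>"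
    if \<sigma>: "((x1, y1), (x2, y2)) \<in> \<sigma>" and x: "x \<in> (\<Union>A\<in>C. X A)" for x1 y1 x2 y2 x
  proof -
    from carr[OF \<sigma>] obtain A where "A \<in> C" "x1 \<in> X A" by (auto simp: band_carr)
    \<comment> \<open>Here \<open>y\<close> only serves to give the left factor
      \<open>(x, y)\<close> the range \<open>A\<close>; it disappears from the products.\<close>
    moreover obtain y where "y \<in> Y A" using nonempty_Y[OF \<open>A \<in> C\<close>] by blast
    ultimately show ?thesis
      using left[OF \<sigma>, of "(x, y)"] objs[OF \<sigma>] x
      by (auto simp: partial_rectangular_band_def split: if_splits)
  qed
  \<comment> \<open>By \<open>change_Y\<close> a single \<open>y\<close> would already force all of
    them. Asking for every \<open>y\<close> lets symmetry and transitivity be inherited from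
    \<sigma> at each \<open>y\<close> separately, with no need to find a common one.\<close>
  define E1 where "E1 = (\<lambda>A\<in>C. {(x1, x2). x1 \<in> X A \<and> x2 \<in> X A \<and>
      (\<forall>y\<in>(\<Union>B\<in>C. Y B). ((x1, y), (x2, y)) \<in> \<sigma>)})"
  define E2 where "E2 = (\<lambda>B\<in>C. {(y1, y2). y1 \<in> Y B \<and> y2 \<in> Y B \<and>
      (\<forall>x\<in>(\<Union>A\<in>C. X A). ((x, y1), (x, y2)) \<in> \<sigma>)})"
  have "equiv (X A) (E1 A)" if "A \<in> C" for A
  proof (rule equivI)
    show "E1 A \<subseteq> X A \<times> X A" using that by (auto simp: E1_def)
    show "refl_on (X A) (E1 A)" using that refl by (auto simp: E1_def refl_on_def band_carr)
    show "sym (E1 A)" using that sym by (auto simp: E1_def sym_def)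
    show "trans (E1 A)" using that trans by (auto simp: E1_def trans_def) blast
  qed
  then have E1: "E1 \<in> Eqs_X" by (auto simp: Eq_def E1_def)
  have "equiv (Y A) (E2 A)" if "A \<in> C" for A
  proof (rule equivI)
    show "E2 A \<subseteq> Y A \<times> Y A" using that by (auto simp: E2_def)
    show "refl_on (Y A) (E2 A)" using that refl by (auto simp: E2_def refl_on_def band_carr)
    show "sym (E2 A)" using that sym by (auto simp: E2_def sym_def)
    show "trans (E2 A)" using that trans by (auto simp: E2_def trans_def) blast
  qed
  then have E2: "E2 \<in> Eqs_Y" by (auto simp: Eq_def E2_def)
  have "p \<in> \<sigma> \<longleftrightarrow> p \<in> sigma_rel C X Y E1 E2" for p
  proof -
    obtain x1 y1 x2 y2 where p: "p = ((x1, y1), (x2, y2))" by (metis surj_pair)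
    show ?thesis
    proof
      assume "p \<in> \<sigma>"
      then have \<sigma>: "((x1, y1), (x2, y2)) \<in> \<sigma>" by (simp add: p)
      from carr[OF \<sigma>] obtain A B A' B' where mem: "A \<in> C" "x1 \<in> X A" "B \<in> C" "y1 \<in> Y B"
        "A' \<in> C" "x2 \<in> X A'" "B' \<in> C" "y2 \<in> Y B'" by (auto simp: band_carr)
      \<comment> \<open>Congruent elements have equal domains and ranges, so both pairs lie in one
        block \<open>X A \<times> Y B\<close>.\<close>
      with objs[OF \<sigma>] have "A' = A" "B' = B" by (auto simp: partial_rectangular_band_def)
      with mem change_X[OF \<sigma>] change_Y[OF \<sigma>] show "p \<in> sigma_rel C X Y E1 E2"
        by (simp add: p sigma_rel_iff[OF E1 E2 mem(1,3,2,4)]) (auto simp: E1_def E2_def)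
    next
      assume "p \<in> sigma_rel C X Y E1 E2"
      then obtain A B where mem: "A \<in> C" "B \<in> C" "x2 \<in> X A" "y1 \<in> Y B"
        and "(x1, x2) \<in> E1 A" "(y1, y2) \<in> E2 B" by (auto simp: p sigma_rel_def)
      \<comment> \<open>The two coordinates are changed one after the other, with
        \<open>(x2, y1)\<close> as the intermediate element: \<open>E1\<close> is used at
        \<open>y1\<close> and \<open>E2\<close> at \<open>x2\<close>.\<close>
      then have "((x1, y1), (x2, y1)) \<in> \<sigma>" "((x2, y1), (x2, y2)) \<in> \<sigma>"
        by (auto simp: E1_def E2_def)
      then show "p \<in> \<sigma>" unfolding p by (rule trans)
    qed
  qed
  then have "\<sigma> = sigma_rel C X Y E1 E2" by blast
  with E1 E2 show thesis by (rule that)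
qed

lemma Cong_band:
  "Cong band = {sigma_rel C X Y E1 E2 | E1 E2. E1 \<in> Eqs_X \<and> E2 \<in> Eqs_Y}"
proof (intro equalityI subsetI)
  fix \<sigma> assume "\<sigma> \<in> Cong band"
  then show "\<sigma> \<in> {sigma_rel C X Y E1 E2 | E1 E2. E1 \<in> Eqs_X \<and> E2 \<in> Eqs_Y}"
    by (rule Cong_imp_sigma_rel) blast
qed (auto intro: sigma_rel_in_Cong)

section \<open>Comparison of the orders and the isomorphism\<close>

text \<open>Components can be read off along slices: for a fixed \<open>y\<close> in
  \<open>Y A\<close>, relating \<open>(x1, y)\<close> to \<open>(x2, y)\<close> is the same as
  having \<open>(x1, x2)\<close> in \<open>E1 A\<close>, and dually for \<open>E2\<close>.
  Non-emptiness provides the fixed points.\<close>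

lemma sigma_rel_subset_iff:
  assumes E: "E1 \<in> Eqs_X" "E2 \<in> Eqs_Y" and F: "F1 \<in> Eqs_X" "F2 \<in> Eqs_Y"
  shows "sigma_rel C X Y E1 E2 \<subseteq> sigma_rel C X Y F1 F2 \<longleftrightarrow>
    (\<forall>A\<in>C. E1 A \<subseteq> F1 A) \<and> (\<forall>A\<in>C. E2 A \<subseteq> F2 A)"
proof
  assume sub: "sigma_rel C X Y E1 E2 \<subseteq> sigma_rel C X Y F1 F2"
  have "E1 A \<subseteq> F1 A \<and> E2 A \<subseteq> F2 A" if A: "A \<in> C" for A
  proof -
    have eqv: "equiv (X A) (E1 A)" "equiv (Y A) (E2 A)"
      using E A by (auto simp: PiE_iff Eq_def)
    obtain x y where xy: "x \<in> X A" "y \<in> Y A"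
      using nonempty_X[OF A] nonempty_Y[OF A] by blast
    have refl: "(x, x) \<in> E1 A" "(y, y) \<in> E2 A"
      using eqv xy by (auto simp: equiv_def refl_on_def)
    have "(x1, x2) \<in> F1 A" if "(x1, x2) \<in> E1 A" for x1 x2
    proof -
      have "x1 \<in> X A" using eqv that by (auto simp: equiv_def)
      then have "((x1, y), (x2, y)) \<in> sigma_rel C X Y E1 E2"
        using that refl xy A by (simp add: sigma_rel_iff[OF E])
      with sub have "((x1, y), (x2, y)) \<in> sigma_rel C X Y F1 F2" by blast
      with \<open>x1 \<in> X A\<close> xy A show ?thesis by (simp add: sigma_rel_iff[OF F])
    qed
    moreover have "(y1, y2) \<in> F2 A" if "(y1, y2) \<in> E2 A" for y1 y2
    proof -
      have "y1 \<in> Y A" using eqv that by (auto simp: equiv_def)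
      then have "((x, y1), (x, y2)) \<in> sigma_rel C X Y E1 E2"
        using that refl xy A by (simp add: sigma_rel_iff[OF E])
      with sub have "((x, y1), (x, y2)) \<in> sigma_rel C X Y F1 F2" by blast
      with \<open>y1 \<in> Y A\<close> xy A show ?thesis by (simp add: sigma_rel_iff[OF F])
    qed
    ultimately show ?thesis by auto
  qed
  then show "(\<forall>A\<in>C. E1 A \<subseteq> F1 A) \<and> (\<forall>A\<in>C. E2 A \<subseteq> F2 A)" by blast
next
  assume "(\<forall>A\<in>C. E1 A \<subseteq> F1 A) \<and> (\<forall>A\<in>C. E2 A \<subseteq> F2 A)"
  then show "sigma_rel C X Y E1 E2 \<subseteq> sigma_rel C X Y F1 F2"
    unfolding sigma_rel_def by (intro UN_mono order_refl) blast
qed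

lemma lattice_isomorphic_Cong_band:
  "lattice_isomorphic (Cong_lattice band)
     (binary_product_order
        (product_order C (\<lambda>A. Eq_lattice (X A)))
        (product_order C (\<lambda>A. Eq_lattice (Y A))))" (is "lattice_isomorphic ?L ?M")
proof -
  let ?g = "\<lambda>(E1, E2). sigma_rel C X Y E1 E2"
  have carrier_L: "carrier ?L = Cong band"
    by (simp add: Cong_lattice_def inclusion_order_def)
  have carrier_M: "carrier ?M = Eqs_X \<times> Eqs_Y"
    by (simp add: binary_product_order_def product_order_def Eq_lattice_def inclusion_order_def)
  have emb: "?g E \<subseteq> ?g F \<longleftrightarrow> E \<sqsubseteq>\<^bsub>?M\<^esub> F" if "E \<in> carrier ?M" "F \<in> carrier ?M" for E F
    using that unfolding carrier_M
    by (cases E; cases F) (simp add: sigma_rel_subset_iff binary_product_order_def product_order_def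
        Eq_lattice_def inclusion_order_def)
  have lat: "lattice ?M"
    by (intro lattice_binary_product_order lattice_product_order lattice_Eq_lattice)
  then interpret M: lattice ?M .
  have "inj_on ?g (carrier ?M)"
  proof (rule inj_onI)
    fix E F assume EF: "E \<in> carrier ?M" "F \<in> carrier ?M" and "?g E = ?g F"
    \<comment> \<open>Equal images are included in each other, so the order embedding and
      antisymmetry in the product yield injectivity.\<close>
    then have "E \<sqsubseteq>\<^bsub>?M\<^esub> F" "F \<sqsubseteq>\<^bsub>?M\<^esub> E" using emb[OF EF] emb[OF EF(2,1)] by simp_all
    with EF show "E = F" by (intro M.le_antisym)
  qed
  moreover have "?g ` carrier ?M = carrier ?L"
    unfolding carrier_L carrier_M Cong_band by (force simp: image_iff)
  ultimately have bij: "bij_betw ?g (carrier ?M) (carrier ?L)" by (simp add: bij_betw_def)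
  \<comment> \<open>The explicit map \<open>?g\<close> runs from tuples to congruences, whereas the
    isomorphism is wanted from congruences to the product, whose lattice structure is already
    established; hence the inverse.\<close>
  let ?h = "inv_into (carrier ?M) ?g"
  show ?thesis
  proof (rule lattice_isomorphicI[OF lat])
    show "bij_betw ?h (carrier ?L) (carrier ?M)" using bij by (rule bij_betw_inv_into)
    fix \<sigma> \<tau> assume "\<sigma> \<in> carrier ?L" "\<tau> \<in> carrier ?L"
    then have "?h \<sigma> \<in> carrier ?M" "?h \<tau> \<in> carrier ?M" "?g (?h \<sigma>) = \<sigma>" "?g (?h \<tau>) = \<tau>"
      using bij bij_betw_inv_into[OF bij] by (auto simp: bij_betw_def f_inv_into_f)
    with emb[of "?h \<sigma>" "?h \<tau>"] show "?h \<sigma> \<sqsubseteq>\<^bsub>?M\<^esub> ?h \<tau> \<longleftrightarrow> \<sigma> \<sqsubseteq>\<^bsub>?L\<^esub> \<tau>"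
      by (simp add: Cong_lattice_def inclusion_order_def)
  qed (simp add: Cong_lattice_def inclusion_order_def)
qed

end

theorem proposition4p7:
  fixes C :: "'c set" and X :: "'c \<Rightarrow> 'x set" and Y :: "'c \<Rightarrow> 'y set"
  assumes "disjoint_family_on X C" and "\<And>A. A \<in> C \<Longrightarrow> X A \<noteq> {}"
    and "disjoint_family_on Y C" and "\<And>A. A \<in> C \<Longrightarrow> Y A \<noteq> {}"
  shows
    "Cong (partial_rectangular_band C X Y) =
       {sigma_rel C X Y E1 E2 | E1 E2.
          E1 \<in> (\<Pi>\<^sub>E A\<in>C. Eq (X A)) \<and> E2 \<in> (\<Pi>\<^sub>E A\<in>C. Eq (Y A))}
     \<and> lattice_isomorphic
         (Cong_lattice (partial_rectangular_band C X Y))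
         (binary_product_order
            (product_order C (\<lambda>A. Eq_lattice (X A)))
            (product_order C (\<lambda>A. Eq_lattice (Y A))))"
proof -
  interpret rectangular_band_data C X Y
    using assms by unfold_locales
  show ?thesis
    using Cong_band lattice_isomorphic_Cong_band by blast
qed

end
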